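(* For every real number $\epsilon>0$, the rational divisor graph $Q[1,7+\epsilon)$ contains $K_{3,3}$ as a minor, and hence is non-planar.
   Context: For a subset $S\subseteq\mathbb{Q}$, the rational divisor graph $Q(S)$ is the simple graph with vertex set $S$ in which $u,v\in S$ are adjacent if and only if $u\neq v$ and either $u=nv$ or $v=nu$ for some $n\in\mathbb{N}=\{1,2,3,\ldots\}$. $Q[1,7+\epsilon)$ denotes $Q([1,7+\epsilon)\cap\mathbb{Q})$. A graph is planar if it can be drawn in the plane without edge crossings. $K_{3,3}$ is the complete bipartite graph with both parts of size $3$. *)

theory Defs
  imports "Graph_Theory.Graph_Theory" "HOL-Analysis.Analysis"
begin

text \<open>
  Following \<^theory>\<open>Graph_Theory.Digraph\<close>, a simple graph is a loop-free symmetric digraph whose arcs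
  are pairs of vertices (\<^locale>\<open>pair_bidirected_digraph\<close>), so each edge is represented by both of
  its orientations.  Vertex sets may be infinite.
\<close>

definition rational_divisor_graph :: "rat set \<Rightarrow> rat pair_pre_digraph" where
  "rational_divisor_graph S =
    \<lparr> pverts = S,
      parcs = {(u, v). u \<in> S \<and> v \<in> S \<and> u \<noteq> v \<and>
                 (\<exists>n::nat. n \<ge> 1 \<and> (u = of_nat n * v \<or> v = of_nat n * u))} \<rparr>"

lemma pair_bidirected_digraph_rational_divisor_graph:
  "pair_bidirected_digraph (rational_divisor_graph S)"
  by unfold_locales
    (auto simp: rational_divisor_graph_def symmetric_def intro!: symI)

text \<open>
  \<open>H\<close> is a minor of \<open>G\<close>: there are pairwise disjoint branch sets \<open>B x\<close>, one for each vertex \<open>x\<close> of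
  \<open>H\<close>, each inducing a connected subgraph of \<open>G\<close>, such that every edge \<open>xy\<close> of \<open>H\<close> is realised by an
  edge of \<open>G\<close> between \<open>B x\<close> and \<open>B y\<close>.  The constant \<open>Digraph_Component.connected\<close> is graph
  connectedness and excludes the null graph, so branch sets are nonempty.
\<close>

definition minor_of :: "'a pair_pre_digraph \<Rightarrow> 'b pair_pre_digraph \<Rightarrow> bool" where
  "minor_of H G \<longleftrightarrow>
    (\<exists>B :: 'a \<Rightarrow> 'b set.
      (\<forall>x \<in> pverts H. B x \<subseteq> pverts G \<and> Digraph_Component.connected (with_proj G \<restriction> B x)) \<and>
      (\<forall>x \<in> pverts H. \<forall>y \<in> pverts H. x \<noteq> y \<longrightarrow> B x \<inter> B y = {}) \<and>
      (\<forall>x y. (x, y) \<in> parcs H \<longrightarrow> (\<exists>u \<in> B x. \<exists>v \<in> B y. (u, v) \<in> parcs G)))"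

definition edges :: "'a pair_pre_digraph \<Rightarrow> 'a set set" where
  "edges G = {{u, v} | u v. (u, v) \<in> parcs G}"

text \<open>
  A drawing without crossings places the vertices at distinct points \<open>p v\<close> of the plane and draws
  every edge \<open>e\<close> as an arc (an injective continuous image of the unit interval) \<open>\<gamma> e\<close> joining its two
  ends and meeting no other vertex, such that two different edges meet at most in a common end.
\<close>

definition planar_drawing ::
  "'a pair_pre_digraph \<Rightarrow> ('a \<Rightarrow> complex) \<Rightarrow> ('a set \<Rightarrow> real \<Rightarrow> complex) \<Rightarrow> bool" where
  "planar_drawing G p \<gamma> \<longleftrightarrow>
    inj_on p (pverts G) \<and>
    (\<forall>e \<in> edges G. arc (\<gamma> e) \<and>
       {pathstart (\<gamma> e), pathfinish (\<gamma> e)} = p ` e \<and>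
       path_image (\<gamma> e) \<inter> p ` pverts G = p ` e) \<and>
    (\<forall>e \<in> edges G. \<forall>f \<in> edges G. e \<noteq> f \<longrightarrow>
       path_image (\<gamma> e) \<inter> path_image (\<gamma> f) \<subseteq> p ` (e \<inter> f))"

definition planar :: "'a pair_pre_digraph \<Rightarrow> bool" where
  "planar G \<longleftrightarrow> (\<exists>p \<gamma>. planar_drawing G p \<gamma>)"

end

theory Submission
  imports Defs
begin

text \<open>
The graph contains a subdivision of \<open>K\<^sub>3\<^sub>,\<^sub>3\<close>, however small \<open>\<epsilon>\<close> is.

Consider the map that doubles a point of \<open>[1, 3)\<close> and divides a point of \<open>[3, 6)\<close> by \<open>3\<close>. It maps
\<open>[1, 6)\<close> to itself, moves along edges of the graph, and modulo powers of \<open>6\<close> it is multiplication by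
\<open>2\<close>. So it behaves like a rotation: its orbits do not repeat (\<open>orbit_inj\<close>), some iterate takes a point
arbitrarily close to itself (\<open>near_return\<close>), and orbits run in step, that is, if \<open>n\<close> iterations multiply
one point by \<open>q\<close>, then they multiply \<open>y\<close> by \<open>q\<close> whenever \<open>y\<close> and \<open>q * y\<close> are both in \<open>[1, 6)\<close>
(\<open>orbit_scale\<close>). A
return factor \<open>q\<close> very close to \<open>1\<close> gives three vertices \<open>z\<close>, \<open>z1 = q * z\<close> and \<open>z2 = q * z1\<close> in
\<open>[1, 1 + \<epsilon> / 7)\<close>. Each such vertex \<open>y\<close> is adjacent to \<open>5 * y\<close>, is joined to \<open>6 / 5 * y\<close> through \<open>6 * y\<close>
and to \<open>7 / 3 * y\<close> through \<open>7 * y\<close>, which is still in the window. The orbits of \<open>5 * z\<close>, \<open>6 / 5 * z\<close> and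
\<open>7 / 3 * z\<close> lie in different cosets of the group generated by \<open>2\<close> and \<open>3\<close>, so they are disjoint, and
each of them meets the points attached to \<open>z\<close>, \<open>z1\<close>, \<open>z2\<close> in this order. Contracting the three
orbit segments gives a \<open>K\<^sub>3\<^sub>,\<^sub>3\<close> with the vertices \<open>z\<close>, \<open>z1\<close>, \<open>z2\<close> on one side.

In a planar drawing, the three paths from \<open>z\<close> to \<open>z2\<close> form a theta curve. The three paths leaving
\<open>z1\<close>, without their ends on the curve, form a connected set in its complement that touches the
interiors of all three arcs. No face of a theta curve does so (\<open>theta_no_common_face\<close>); this rests on
the Jordan curve theorem, on Janiszewski's theorem and on the fact that a chord cuts the inside of a closed
curve into two parts.
\<close>

section \<open>Faces of a theta curve\<close>

definition arc_joins :: "complex set \<Rightarrow> complex \<Rightarrow> complex \<Rightarrow> bool" where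
  "arc_joins C a b \<longleftrightarrow> (\<exists>g. arc g \<and> pathstart g = a \<and> pathfinish g = b \<and> path_image g = C)"

lemma arc_joins_ends: "arc_joins C a b \<Longrightarrow> {a, b} \<subseteq> C \<and> a \<noteq> b"
  unfolding arc_joins_def
  using arc_distinct_ends pathfinish_in_path_image pathstart_in_path_image by fastforce

lemma arc_joins_connected: "arc_joins C a b \<Longrightarrow> Topological_Spaces.connected C"
  unfolding arc_joins_def by (metis arc_imp_path connected_path_image)

lemma arc_joins_compact: "arc_joins C a b \<Longrightarrow> compact C"
  unfolding arc_joins_def by (metis arc_imp_path compact_path_image)

lemma Jordan_two_arcs:
  assumes "arc_joins C a b" "arc_joins D a b" "C \<inter> D = {a, b}"
  shows "inside (C \<union> D) \<noteq> {}" "open (inside (C \<union> D))" "Topological_Spaces.connected (inside (C \<union> D))"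
    "Topological_Spaces.connected (outside (C \<union> D))" "open (outside (C \<union> D))" "frontier (inside (C \<union> D)) = C \<union> D"
proof -
  obtain g h where g: "arc g" "pathstart g = a" "pathfinish g = b" "path_image g = C"
    and h: "arc h" "pathstart h = a" "pathfinish h = b" "path_image h = D"
    using assms unfolding arc_joins_def by metis
  have "simple_path (g +++ reversepath h)"
    using g h assms(3) by (intro simple_path_join_loop) (auto simp: arc_reversepath)
  moreover have "pathfinish (g +++ reversepath h) = pathstart (g +++ reversepath h)"
    using g h by simp
  moreover have "path_image (g +++ reversepath h) = C \<union> D"
    using g h by (simp add: path_image_join)
  ultimately show "inside (C \<union> D) \<noteq> {}" "open (inside (C \<union> D))" "Topological_Spaces.connected (inside (C \<union> D))"
    "Topological_Spaces.connected (outside (C \<union> D))" "open (outside (C \<union> D))" "frontier (inside (C \<union> D)) = C \<union> D"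
    using Jordan_inside_outside[of "g +++ reversepath h"] by simp_all
qed

lemma connected_subset_inside:
  assumes "Topological_Spaces.connected X" "X \<inter> S = {}" "X \<inter> inside S \<noteq> {}"
  shows "X \<subseteq> inside S"
proof
  fix x assume "x \<in> X"
  obtain y where y: "y \<in> X" "y \<in> inside S" using assms(3) by blast
  have "connected_component (- S) y x"
    unfolding connected_component_def using assms y \<open>x \<in> X\<close> by blast
  then show "x \<in> inside S" using inside_same_component y(2) by metis
qed

text \<open>
If the two insides met, the first, being connected and off the second curve, would lie in the
second one; taking closures, so would the inner points of \<open>C2\<close>, against the assumption.
\<close>

lemma inside_disjoint_of_arcs_outside:
  assumes C: "arc_joins C1 a b" "arc_joins C2 a b" "arc_joins C3 a b"
    and I: "C1 \<inter> C2 = {a, b}" "C1 \<inter> C3 = {a, b}" "C2 \<inter> C3 = {a, b}"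
    and out: "C3 \<inter> inside (C1 \<union> C2) = {}" "C2 \<inter> inside (C1 \<union> C3) = {}"
    and q: "q \<in> C2 - {a, b}"
  shows "inside (C1 \<union> C2) \<inter> inside (C1 \<union> C3) = {}"
proof (rule ccontr)
  assume ne: "inside (C1 \<union> C2) \<inter> inside (C1 \<union> C3) \<noteq> {}"
  have "inside (C1 \<union> C2) \<inter> (C1 \<union> C3) = {}"
    using out(1) inside_no_overlap[of "C1 \<union> C2"] by blast
  then have "inside (C1 \<union> C2) \<subseteq> inside (C1 \<union> C3)"
    using connected_subset_inside Jordan_two_arcs(3)[OF C(1,2) I(1)] ne by blast
  then have "closure (inside (C1 \<union> C2)) \<subseteq> closure (inside (C1 \<union> C3))"
    by (rule closure_mono)
  moreover have "q \<in> closure (inside (C1 \<union> C2))"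
    using Jordan_two_arcs(6)[OF C(1,2) I(1)] q unfolding frontier_def by blast
  moreover have "closure (inside (C1 \<union> C3)) = inside (C1 \<union> C3) \<union> (C1 \<union> C3)"
    using Jordan_two_arcs(6)[OF C(1,3) I(2)] by (metis closure_Un_frontier)
  ultimately have "q \<in> inside (C1 \<union> C3) \<union> (C1 \<union> C3)" by blast
  then show False using q I(1,3) out(2) by blast
qed

text \<open>
If every arc avoids the inside of the curve formed by the other two, then a point \<open>x\<close> inside
\<open>C1 \<union> C2\<close> and a point \<open>y\<close> far away both lie outside \<open>C1 \<union> C3\<close> and outside \<open>C2 \<union> C3\<close>. These two
curves have the connected intersection \<open>C3\<close>, so by Janiszewski's theorem their union, the whole
theta curve, does not separate \<open>x\<close> from \<open>y\<close>, although \<open>C1 \<union> C2\<close> does.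
\<close>

lemma theta_arc_inside:
  assumes C: "arc_joins C1 a b" "arc_joins C2 a b" "arc_joins C3 a b"
    and I: "C1 \<inter> C2 = {a, b}" "C1 \<inter> C3 = {a, b}" "C2 \<inter> C3 = {a, b}"
    and q: "q1 \<in> C1 - {a, b}" "q2 \<in> C2 - {a, b}"
  shows "C3 \<inter> inside (C1 \<union> C2) \<noteq> {} \<or> C2 \<inter> inside (C1 \<union> C3) \<noteq> {} \<or> C1 \<inter> inside (C2 \<union> C3) \<noteq> {}"
proof (rule ccontr)
  assume "\<not> ?thesis"
  then have out: "C3 \<inter> inside (C1 \<union> C2) = {}" "C2 \<inter> inside (C1 \<union> C3) = {}"
    "C1 \<inter> inside (C2 \<union> C3) = {}" by auto
  have out': "C3 \<inter> inside (C2 \<union> C1) = {}" using out(1) by (simp add: Un_commute)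
  have I': "C2 \<inter> C1 = {a, b}" using I(1) by blast
  obtain x where x: "x \<in> inside (C1 \<union> C2)"
    using Jordan_two_arcs(1)[OF C(1,2) I(1)] by blast
  have xn: "x \<notin> C1 \<union> C2" "x \<notin> C3"
    using x out(1) inside_no_overlap[of "C1 \<union> C2"] by blast+
  have "bounded (C1 \<union> C2 \<union> C3)"
    using C by (simp add: arc_joins_compact compact_imp_bounded)
  then obtain y where y: "y \<in> outside (C1 \<union> C2 \<union> C3)"
    using outside_bounded_nonempty by blast
  have y12: "y \<in> outside (C1 \<union> C2)" and y13: "y \<in> outside (C1 \<union> C3)" and y23: "y \<in> outside (C2 \<union> C3)"
    using y outside_mono[of "C1 \<union> C2" "C1 \<union> C2 \<union> C3"] outside_mono[of "C1 \<union> C3" "C1 \<union> C2 \<union> C3"]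
      outside_mono[of "C2 \<union> C3" "C1 \<union> C2 \<union> C3"] by blast+
  have "x \<notin> inside (C1 \<union> C3)"
    using inside_disjoint_of_arcs_outside[OF C I out(1,2) q(2)] x by blast
  then have x13: "x \<in> outside (C1 \<union> C3)" using xn union_with_inside[of "C1 \<union> C3"] inside_Un_outside[of "C1 \<union> C3"] by blast
  have "x \<notin> inside (C2 \<union> C3)"
    using inside_disjoint_of_arcs_outside[OF C(2,1,3) I' I(3,2) out' out(3) q(1)] x by (auto simp: Un_commute)
  then have x23: "x \<in> outside (C2 \<union> C3)" using xn inside_Un_outside[of "C2 \<union> C3"] by blast
  have cc: "connected_component (- S) x y" if "Topological_Spaces.connected (outside S)" "x \<in> outside S" "y \<in> outside S" for S
    unfolding connected_component_def using that outside_no_overlap[of S] by blast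
  have "connected_component (- ((C1 \<union> C3) \<union> (C2 \<union> C3))) x y"
  proof (rule Janiszewski)
    show "compact (C1 \<union> C3)" "closed (C2 \<union> C3)"
      using C by (auto simp: arc_joins_compact compact_Un compact_imp_closed)
    have "(C1 \<union> C3) \<inter> (C2 \<union> C3) = C3" using I by blast
    then show "Topological_Spaces.connected ((C1 \<union> C3) \<inter> (C2 \<union> C3))" using C(3) by (simp add: arc_joins_connected)
    show "connected_component (- (C1 \<union> C3)) x y"
      using cc Jordan_two_arcs(4)[OF C(1,3) I(2)] x13 y13 by blast
    show "connected_component (- (C2 \<union> C3)) x y"
      using cc Jordan_two_arcs(4)[OF C(2,3) I(3)] x23 y23 by blast
  qed
  then have "connected_component (- (C1 \<union> C2)) x y"
    by (rule connected_component_of_subset) blast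
  then have "x \<in> outside (C1 \<union> C2)"
    using y12 outside_same_component connected_component_sym by metis
  then show False using x inside_Int_outside by blast
qed

text \<open>
The chord \<open>C3\<close> cuts the inside of \<open>C1 \<union> C2\<close> into the insides of \<open>C1 \<union> C3\<close> and \<open>C2 \<union> C3\<close>. The set
\<open>T\<close> comes close to \<open>C3\<close> and is therefore in one of the two parts, but neither of them has inner
points of both \<open>C1\<close> and \<open>C2\<close> on its boundary.
\<close>

lemma chord_separates:
  assumes C: "arc_joins C1 a b" "arc_joins C2 a b" "arc_joins C3 a b"
    and I: "C1 \<inter> C2 = {a, b}" "C1 \<inter> C3 = {a, b}" "C2 \<inter> C3 = {a, b}"
    and ins: "C3 \<inter> inside (C1 \<union> C2) \<noteq> {}"
    and T: "Topological_Spaces.connected T" "T \<inter> (C1 \<union> C2 \<union> C3) = {}"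
    and q: "q1 \<in> C1 - {a, b}" "q2 \<in> C2 - {a, b}" "q3 \<in> C3 - {a, b}" "{q1, q2, q3} \<subseteq> closure T"
  shows False
proof -
  have split: "inside (C1 \<union> C3) \<union> inside (C2 \<union> C3) \<union> (C3 - {a, b}) = inside (C1 \<union> C2)"
  proof -
    obtain f where f: "arc f" "pathstart f = a" "pathfinish f = b" "path_image f = C1"
      using C(1) unfolding arc_joins_def by metis
    obtain g where g: "arc g" "pathstart g = a" "pathfinish g = b" "path_image g = C2"
      using C(2) unfolding arc_joins_def by metis
    obtain h where h: "arc h" "pathstart h = a" "pathfinish h = b" "path_image h = C3"
      using C(3) unfolding arc_joins_def by metis
    have sp: "simple_path f" "simple_path g" "simple_path h"
      using f g h by (simp_all add: arc_imp_simple_path)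
    have "a \<noteq> b" using C arc_joins_ends by blast
    show ?thesis
      by (rule split_inside_simple_closed_curve[OF sp(1) f(2,3) sp(2) g(2,3) sp(3) h(2,3) \<open>a \<noteq> b\<close>])
        (use f g h I ins in simp_all)
  qed
  have cl: "closure (inside (C \<union> C3)) = inside (C \<union> C3) \<union> (C \<union> C3)"
    if "arc_joins C a b" "C \<inter> C3 = {a,b}" for C
    using Jordan_two_arcs(6)[OF that(1) C(3) that(2)] by (metis closure_Un_frontier)
  have no: "inside (C1 \<union> C2) \<inter> (C1 \<union> C2) = {}" by (rule inside_no_overlap)
  \<comment> \<open>\<open>T\<close> accumulates at \<open>q3\<close>, so it meets every open set that contains \<open>q3\<close>.\<close>
  have "q3 \<in> inside (C1 \<union> C2)" using split q(3) by blast
  then have "T \<inter> inside (C1 \<union> C2) \<noteq> {}"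
    using Jordan_two_arcs(2)[OF C(1,2) I(1)] q(4) open_Int_closure_eq_empty[of "inside (C1 \<union> C2)" T] by blast
  then have "T \<inter> inside (C1 \<union> C3) \<noteq> {} \<or> T \<inter> inside (C2 \<union> C3) \<noteq> {}"
    using split T(2) by blast
  then have "T \<subseteq> inside (C1 \<union> C3) \<or> T \<subseteq> inside (C2 \<union> C3)"
    using connected_subset_inside[OF T(1), of "C1 \<union> C3"] connected_subset_inside[OF T(1), of "C2 \<union> C3"] T(2) by blast
  then show False
  proof
    assume "T \<subseteq> inside (C1 \<union> C3)"
    then have "q2 \<in> inside (C1 \<union> C3) \<union> (C1 \<union> C3)"
      using closure_mono[of T "inside (C1 \<union> C3)"] cl[OF C(1) I(2)] q(4) by auto
    then show False using q(2) I no split by blast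
  next
    assume "T \<subseteq> inside (C2 \<union> C3)"
    then have "q1 \<in> inside (C2 \<union> C3) \<union> (C2 \<union> C3)"
      using closure_mono[of T "inside (C2 \<union> C3)"] cl[OF C(2) I(3)] q(4) by auto
    then show False using q(1) I no split by blast
  qed
qed

text \<open>
No face of a theta curve touches the interiors of all three arcs. One of the arcs is a chord inside
the curve formed by the other two, and the statement is symmetric in the arcs.
\<close>

theorem theta_no_common_face:
  assumes C: "arc_joins C1 a b" "arc_joins C2 a b" "arc_joins C3 a b"
    and I: "C1 \<inter> C2 = {a, b}" "C1 \<inter> C3 = {a, b}" "C2 \<inter> C3 = {a, b}"
    and T: "Topological_Spaces.connected T" "T \<inter> (C1 \<union> C2 \<union> C3) = {}"
    and q: "q1 \<in> C1 - {a, b}" "q2 \<in> C2 - {a, b}" "q3 \<in> C3 - {a, b}" "{q1, q2, q3} \<subseteq> closure T"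
  shows False
proof -
  have T': "T \<inter> (C1 \<union> C3 \<union> C2) = {}" "T \<inter> (C2 \<union> C3 \<union> C1) = {}" using T(2) by blast+
  have I': "C2 \<inter> C1 = {a, b}" "C3 \<inter> C1 = {a, b}" "C3 \<inter> C2 = {a, b}" using I by blast+
  have q': "{q1, q3, q2} \<subseteq> closure T" "{q2, q3, q1} \<subseteq> closure T" using q(4) by auto
  from theta_arc_inside[OF C I q(1,2)] show False
  proof (elim disjE)
    assume "C3 \<inter> inside (C1 \<union> C2) \<noteq> {}"
    from chord_separates[OF C I this T q] show False .
  next
    assume "C2 \<inter> inside (C1 \<union> C3) \<noteq> {}"
    from chord_separates[OF C(1,3,2) I(2,1) I'(3) this T(1) T'(1) q(1,3,2) q'(1)] show False .
  next
    assume "C1 \<inter> inside (C2 \<union> C3) \<noteq> {}"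
    from chord_separates[OF C(2,3,1) I(3) I'(1,2) this T(1) T'(2) q(2,3,1) q'(2)] show False .
  qed
qed

section \<open>Walks and their drawings\<close>

definition walk :: "'a pair_pre_digraph \<Rightarrow> 'a list \<Rightarrow> bool" where
  "walk G xs \<longleftrightarrow> successively (\<lambda>u v. (u, v) \<in> parcs G) xs"

definition simple_walk :: "'a pair_pre_digraph \<Rightarrow> 'a list \<Rightarrow> bool" where
  "simple_walk G xs \<longleftrightarrow> walk G xs \<and> distinct xs"

fun walk_edges :: "'a list \<Rightarrow> 'a set set" where
  "walk_edges (u # v # xs) = insert {u, v} (walk_edges (v # xs))"
| "walk_edges _ = {}"

definition drawn_walk :: "('a set \<Rightarrow> real \<Rightarrow> complex) \<Rightarrow> 'a list \<Rightarrow> complex set" where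
  "drawn_walk \<gamma> xs = (\<Union>e \<in> walk_edges xs. path_image (\<gamma> e))"

lemma walk_edges_subset_edges: "walk G xs \<Longrightarrow> walk_edges xs \<subseteq> edges G"
  unfolding walk_def by (induction xs rule: walk_edges.induct) (auto simp: edges_def)

lemma walk_edges_subset_set: "e \<in> walk_edges xs \<Longrightarrow> e \<subseteq> set xs"
  by (induction xs rule: walk_edges.induct) auto

lemma card_walk_edge: "distinct xs \<Longrightarrow> e \<in> walk_edges xs \<Longrightarrow> card e = 2"
  by (induction xs rule: walk_edges.induct) auto

text \<open>
With three vertices or more, a simple walk has no edge joining its two ends. Hence two such walks
that share only their ends have no common edge.
\<close>

lemma ends_not_walk_edge:
  assumes "distinct xs" "length xs \<ge> 3"
  shows "{hd xs, last xs} \<notin> walk_edges xs"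
proof -
  obtain u v w ws where xs: "xs = u # v # w # ws"
    using assms(2) by (cases xs; cases "tl xs"; cases "tl (tl xs)") auto
  have "u \<notin> e" if "e \<in> walk_edges (v # w # ws)" for e
    using walk_edges_subset_set[OF that] assms(1) xs by auto
  moreover have "last (w # ws) \<in> set (w # ws)" by (rule last_in_set) simp
  then have "last (w # ws) \<noteq> v" "last (w # ws) \<noteq> u" using assms(1) xs by auto
  ultimately show ?thesis using xs by (auto simp: doubleton_eq_iff)
qed

lemma set_subset_Union_walk_edges: "length xs \<ge> 2 \<Longrightarrow> set xs \<subseteq> \<Union> (walk_edges xs)"
proof (induction xs rule: walk_edges.induct)
  case (1 u v xs)
  then show ?case by (cases xs) auto
qed auto

lemma drawn_walk_contains_vertices:
  assumes "planar_drawing G p \<gamma>" "walk G xs" "length xs \<ge> 2" "v \<in> set xs"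
  shows "p v \<in> drawn_walk \<gamma> xs"
proof -
  obtain e where e: "e \<in> walk_edges xs" "v \<in> e"
    using set_subset_Union_walk_edges[OF assms(3)] assms(4) by blast
  then have "p ` e \<subseteq> path_image (\<gamma> e)"
    using walk_edges_subset_edges[OF assms(2)] assms(1) unfolding planar_drawing_def by blast
  then show ?thesis using e unfolding drawn_walk_def by blast
qed

lemma drawn_walks_meet:
  assumes d: "planar_drawing G p \<gamma>" and "walk G xs" "walk G ys" "walk_edges xs \<inter> walk_edges ys = {}"
  shows "drawn_walk \<gamma> xs \<inter> drawn_walk \<gamma> ys \<subseteq> p ` (set xs \<inter> set ys)"
proof
  fix z assume "z \<in> drawn_walk \<gamma> xs \<inter> drawn_walk \<gamma> ys"
  then obtain e f where ef: "e \<in> walk_edges xs" "f \<in> walk_edges ys"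
    "z \<in> path_image (\<gamma> e)" "z \<in> path_image (\<gamma> f)"
    unfolding drawn_walk_def by blast
  then have "e \<in> edges G" "f \<in> edges G" "e \<noteq> f"
    using walk_edges_subset_edges assms(2,3,4) by blast+
  then have "z \<in> p ` (e \<inter> f)" using d ef(3,4) unfolding planar_drawing_def by blast
  then show "z \<in> p ` (set xs \<inter> set ys)"
    using walk_edges_subset_set ef(1,2) by fast
qed

lemma arc_joins_sym: "arc_joins C a b \<Longrightarrow> arc_joins C b a"
  unfolding arc_joins_def by (metis arc_reversepath path_image_reversepath
      pathfinish_reversepath pathstart_reversepath)

lemma arc_joins_edge:
  assumes d: "planar_drawing G p \<gamma>" and e: "{u, v} \<in> edges G"
  shows "arc_joins (path_image (\<gamma> {u, v})) (p u) (p v)"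
proof -
  have a: "arc (\<gamma> {u, v})" "{pathstart (\<gamma> {u, v}), pathfinish (\<gamma> {u, v})} = {p u, p v}"
    using d e unfolding planar_drawing_def by auto
  then have "arc_joins (path_image (\<gamma> {u, v})) (pathstart (\<gamma> {u, v})) (pathfinish (\<gamma> {u, v}))"
    unfolding arc_joins_def by blast
  then show ?thesis using a(2) arc_joins_sym by (auto simp: doubleton_eq_iff)
qed

lemma arc_joins_trans:
  assumes "arc_joins C a b" "arc_joins D b c" "C \<inter> D \<subseteq> {b}"
  shows "arc_joins (C \<union> D) a c"
proof -
  obtain g where g: "arc g" "pathstart g = a" "pathfinish g = b" "path_image g = C"
    using assms(1) unfolding arc_joins_def by metis
  obtain h where h: "arc h" "pathstart h = b" "pathfinish h = c" "path_image h = D"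
    using assms(2) unfolding arc_joins_def by metis
  have "arc (g +++ h)" using g h assms(3) by (intro arc_join) auto
  then show ?thesis using g h unfolding arc_joins_def
    by (intro exI[of _ "g +++ h"]) (simp add: path_image_join)
qed

lemma arc_joins_drawn_walk:
  assumes d: "planar_drawing G p \<gamma>"
  shows "simple_walk G xs \<Longrightarrow> length xs \<ge> 2 \<Longrightarrow> arc_joins (drawn_walk \<gamma> xs) (p (hd xs)) (p (last xs))"
proof (induction xs rule: walk_edges.induct)
  case (1 u v xs)
  have uv: "{u, v} \<in> edges G"
    using "1.prems" by (auto simp: simple_walk_def walk_def edges_def)
  note arc = arc_joins_edge[OF d uv]
  show ?case
  proof (cases "xs = []")
    case True
    then show ?thesis using arc by (simp add: drawn_walk_def)
  next
    case False
    have w: "simple_walk G (v # xs)" and uw: "walk G [u, v]"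
      using "1.prems" by (auto simp: simple_walk_def walk_def)
    have un: "u \<notin> set (v # xs)" using "1.prems" by (auto simp: simple_walk_def)
    have "walk_edges [u, v] \<inter> walk_edges (v # xs) = {}"
      using walk_edges_subset_set[of "{u, v}" "v # xs"] un by auto
    then have "drawn_walk \<gamma> [u, v] \<inter> drawn_walk \<gamma> (v # xs) \<subseteq> p ` (set [u, v] \<inter> set (v # xs))"
      using drawn_walks_meet[OF d uw] w unfolding simple_walk_def by blast
    also have "set [u, v] \<inter> set (v # xs) = {v}" using un by auto
    finally have meet: "path_image (\<gamma> {u, v}) \<inter> drawn_walk \<gamma> (v # xs) \<subseteq> {p v}"
      by (simp add: drawn_walk_def)
    have "arc_joins (drawn_walk \<gamma> (v # xs)) (p v) (p (last (v # xs)))"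
      using "1.IH"[OF w] False by (cases xs) auto
    from arc_joins_trans[OF arc this meet] show ?thesis
      by (simp add: drawn_walk_def)
  qed
qed auto

text \<open>
An arc without its final point stays connected and still accumulates at that point. Three such arcs
with a common initial point form the set to which the lemma on theta curves is applied.
\<close>

lemma arc_joins_minus_end:
  assumes "arc_joins C a b"
  shows "Topological_Spaces.connected (C - {b})" "a \<in> C - {b}" "b \<in> closure (C - {b})"
proof -
  have ab: "{a, b} \<subseteq> C" "a \<noteq> b" using arc_joins_ends[OF assms] by auto
  then show "a \<in> C - {b}" by blast
  obtain g where g: "arc g" "pathfinish g = b" "path_image g = C"
    using assms unfolding arc_joins_def by metis
  have "g ` {0..<1} = C - {b}"
  proof -
    have "g ` ({0..1} - {1}) = g ` {0..1} - g ` {1}"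
      by (rule inj_on_image_set_diff[of g "{0..1}"]) (use g(1) in \<open>auto simp: arc_def\<close>)
    moreover have "{0..1} - {1} = {0..<1::real}" by auto
    ultimately show ?thesis using g by (simp add: path_image_def pathfinish_def)
  qed
  moreover have "Topological_Spaces.connected (g ` {0..<1})"
    using g(1) by (intro connected_continuous_image)
      (auto simp: arc_def path_def intro: continuous_on_subset)
  ultimately show "Topological_Spaces.connected (C - {b})" by simp
  have "b islimpt C"
    using ab by (intro connected_imp_perfect[OF arc_joins_connected[OF assms]]) auto
  then show "b \<in> closure (C - {b})" using islimpt_in_closure by blast
qed

text \<open>
Since connectedness refers to the underlying symmetric graph, it is enough to reach every vertex
from one root.
\<close>

lemma connected_induced_if_rooted:
  assumes c: "c \<in> B"
    and walks: "\<And>v. v \<in> B \<Longrightarrow> \<exists>xs. walk G xs \<and> xs \<noteq> [] \<and> hd xs = c \<and> v \<in> set xs \<and> set xs \<subseteq> B"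
  shows "Digraph_Component.connected (with_proj G \<restriction> B)"
proof -
  let ?H = "with_proj (mk_symmetric (with_proj G \<restriction> B))"
  have arc: "(u, v) \<in> parcs (mk_symmetric (with_proj G \<restriction> B))"
    if "(u, v) \<in> parcs G" "u \<in> B" "v \<in> B" for u v
    using that by (force simp: parcs_mk_symmetric induce_subgraph_def)
  have walk: "hd xs \<rightarrow>\<^sup>*\<^bsub>?H\<^esub> v" if "walk G xs" "set xs \<subseteq> B" "v \<in> set xs" for xs v
    using that
  proof (induction xs)
    case (Cons u xs)
    show ?case
    proof (cases "v = u")
      case True
      then show ?thesis using Cons.prems by (simp add: reachable_def)
    next
      case False
      then have "v \<in> set xs" "xs \<noteq> []" using Cons.prems by auto
      moreover have "walk G xs" "(u, hd xs) \<in> parcs G"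
        using Cons.prems \<open>xs \<noteq> []\<close> by (auto simp: walk_def successively_Cons)
      moreover have "hd xs \<in> B" using Cons.prems \<open>xs \<noteq> []\<close> by (auto dest: hd_in_set)
      ultimately show ?thesis
        using Cons arc[of u "hd xs"] unfolding reachable_def
        by (auto intro: converse_rtrancl_on_into_rtrancl_on)
    qed
  qed simp
  have from_c: "c \<rightarrow>\<^sup>*\<^bsub>?H\<^esub> v" if "v \<in> B" for v
    using walks[OF that] walk by blast
  have "u \<rightarrow>\<^sup>*\<^bsub>?H\<^esub> v" if "u \<in> B" "v \<in> B" for u v
    using symmetric_reachable[OF symmetric_mk_symmetric from_c[OF that(1)]] from_c[OF that(2)]
    unfolding reachable_def by (rule rtrancl_on_trans)
  then show ?thesis
    unfolding Digraph_Component.connected_def strongly_connected_def using c by auto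
qed

section \<open>Subdivisions of the complete bipartite graph\<close>

lemma (in pair_sym_digraph) adj_sym: "(u, v) \<in> parcs G \<Longrightarrow> (v, u) \<in> parcs G"
  using pair_sym_arcs by (auto simp: symmetric_def dest: symD)

text \<open>
A subdivision of \<open>K\<^sub>3\<^sub>,\<^sub>3\<close> given by walks: the branch vertices of one side are \<open>a\<close>, \<open>b\<close> and \<open>c\<close>, those
of the other side are \<open>last (Q 0)\<close>, \<open>last (Q 1)\<close> and \<open>last (Q 2)\<close>. The walk \<open>P k\<close> runs from \<open>a\<close>
through \<open>last (Q k)\<close> to \<open>b\<close>, and \<open>Q k\<close> leads to it from \<open>c\<close>. In this form the \<open>P k\<close> are drawn as a
theta curve and the \<open>Q k\<close> as a tripod.
\<close>

locale K33_subdivision = pair_bidirected_digraph G for G :: "'a pair_pre_digraph" +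
  fixes a b c :: 'a and P Q :: "nat \<Rightarrow> 'a list"
  assumes walk_P: "k < 3 \<Longrightarrow> simple_walk G (P k)"
    and ends_P: "k < 3 \<Longrightarrow> hd (P k) = a" "k < 3 \<Longrightarrow> last (P k) = b"
    and meet_P: "i < 3 \<Longrightarrow> j < 3 \<Longrightarrow> i \<noteq> j \<Longrightarrow> set (P i) \<inter> set (P j) = {a, b}"
    and walk_Q: "k < 3 \<Longrightarrow> simple_walk G (Q k)"
    and hd_Q: "k < 3 \<Longrightarrow> hd (Q k) = c"
    and last_Q: "k < 3 \<Longrightarrow> last (Q k) \<in> set (P k) - {a, b}"
    and meet_Q: "k < 3 \<Longrightarrow> j < 3 \<Longrightarrow> set (Q k) \<inter> set (P j) \<subseteq> {last (Q k)}"
    and c_notin_P: "k < 3 \<Longrightarrow> c \<notin> set (P k)"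
    and nonempty_Q: "k < 3 \<Longrightarrow> Q k \<noteq> []"
begin

definition inner_P :: "nat \<Rightarrow> 'a list" where "inner_P k = butlast (tl (P k))"

definition init_Q :: "nat \<Rightarrow> 'a list" where "init_Q k = butlast (Q k)"

lemma P_eq: assumes "k < 3" shows "P k = a # inner_P k @ [b]"
proof -
  have l: "last (Q k) \<in> set (P k) - {a, b}" by (rule last_Q[OF assms])
  then obtain ys where ys: "P k = a # ys" using ends_P(1)[OF assms] by (cases "P k") auto
  with l have "ys \<noteq> []" by auto
  then have "ys = butlast ys @ [b]"
    using ends_P(2)[OF assms] ys by (metis append_butlast_last_id last_ConsR)
  then show ?thesis using ys by (simp add: inner_P_def)
qed

lemma set_inner_P: assumes "k < 3" shows "set (inner_P k) = set (P k) - {a, b}"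
proof -
  have "distinct (a # inner_P k @ [b])"
    using walk_P[OF assms] P_eq[OF assms] by (simp add: simple_walk_def)
  moreover have "set (P k) = set (a # inner_P k @ [b])" using P_eq[OF assms] by simp
  ultimately show ?thesis by auto
qed

lemma last_Q_inner_P: "k < 3 \<Longrightarrow> last (Q k) \<in> set (inner_P k)"
  using last_Q set_inner_P by simp

lemma inner_P_nonempty: "k < 3 \<Longrightarrow> inner_P k \<noteq> []"
  using last_Q_inner_P by fastforce

lemma walk_inner_P:
  assumes "k < 3"
  shows "walk G (inner_P k)" "(a, hd (inner_P k)) \<in> parcs G" "(last (inner_P k), b) \<in> parcs G"
proof -
  have "walk G (a # inner_P k @ [b])"
    using walk_P[OF assms] P_eq[OF assms] by (simp add: simple_walk_def)
  then show "walk G (inner_P k)" "(a, hd (inner_P k)) \<in> parcs G" "(last (inner_P k), b) \<in> parcs G"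
    using inner_P_nonempty[OF assms] by (auto simp: walk_def successively_Cons successively_append_iff)
qed

lemma length_P: "k < 3 \<Longrightarrow> length (P k) \<ge> 3"
  using P_eq[of k] inner_P_nonempty[of k] by (cases "inner_P k") auto

lemma ends_in_P: assumes "k < 3" shows "a \<in> set (P k)" "b \<in> set (P k)"
proof -
  have "set (P k) = set (a # inner_P k @ [b])" using P_eq[OF assms] by simp
  then show "a \<in> set (P k)" "b \<in> set (P k)" by auto
qed

lemma a_neq_b: "a \<noteq> b"
proof -
  have "distinct (a # inner_P 0 @ [b])"
    using walk_P[of 0] P_eq[of 0] by (simp add: simple_walk_def)
  then show ?thesis by simp
qed

lemma Q_eq: "k < 3 \<Longrightarrow> Q k = init_Q k @ [last (Q k)]"
  using nonempty_Q by (simp add: init_Q_def)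

lemma init_Q_nonempty: assumes "k < 3" shows "init_Q k \<noteq> []"
proof
  assume "init_Q k = []"
  then have "Q k = [last (Q k)]" using Q_eq[OF assms] by simp
  then have "last (Q k) = c" using hd_Q[OF assms] by (metis list.sel(1))
  then show False using last_Q[OF assms] c_notin_P[OF assms] by simp
qed

lemma set_init_Q: assumes "k < 3" shows "set (init_Q k) = set (Q k) - {last (Q k)}"
proof -
  have "distinct (init_Q k @ [last (Q k)])"
    using walk_Q[OF assms] Q_eq[OF assms] by (simp add: simple_walk_def)
  moreover have "set (Q k) = set (init_Q k @ [last (Q k)])" using Q_eq[OF assms] by simp
  ultimately show ?thesis by auto
qed

lemma hd_init_Q: "k < 3 \<Longrightarrow> hd (init_Q k) = c"
  using Q_eq hd_Q init_Q_nonempty by (metis hd_append2)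

lemma walk_init_Q:
  assumes "k < 3"
  shows "walk G (init_Q k)" "(last (init_Q k), last (Q k)) \<in> parcs G"
proof -
  have "walk G (init_Q k @ [last (Q k)])"
    using walk_Q[OF assms] Q_eq[OF assms] by (simp add: simple_walk_def)
  then show "walk G (init_Q k)" "(last (init_Q k), last (Q k)) \<in> parcs G"
    using init_Q_nonempty[OF assms] by (auto simp: walk_def successively_append_iff)
qed

lemma init_Q_disjoint_P: "k < 3 \<Longrightarrow> j < 3 \<Longrightarrow> set (init_Q k) \<inter> set (P j) = {}"
  using set_init_Q meet_Q by blast

lemma length_Q: assumes "k < 3" shows "length (Q k) \<ge> 2"
proof -
  have "length (Q k) = length (init_Q k @ [last (Q k)])" using Q_eq[OF assms] by simp
  then show ?thesis using init_Q_nonempty[OF assms] by (cases "init_Q k") auto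
qed

lemma walk_subset_verts: assumes "walk G xs" "length xs \<ge> 2" shows "set xs \<subseteq> pverts G"
proof -
  have "\<Union> (edges G) \<subseteq> pverts G" using in_arcsD1 in_arcsD2 unfolding edges_def by blast
  then show ?thesis
    using set_subset_Union_walk_edges[OF assms(2)] walk_edges_subset_edges[OF assms(1)] by blast
qed

lemma P_subset_verts: "k < 3 \<Longrightarrow> set (P k) \<subseteq> pverts G"
  using walk_subset_verts[of "P k"] walk_P length_P[of k] by (auto simp: simple_walk_def)

lemma Q_subset_verts: "k < 3 \<Longrightarrow> set (Q k) \<subseteq> pverts G"
  using walk_subset_verts[of "Q k"] walk_Q length_Q[of k] by (auto simp: simple_walk_def)

text \<open>
The tripod without its three feet is connected and avoids the theta curve, so it lies in one face,
and it accumulates at an inner point of each of the three arcs.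
\<close>

theorem not_planar: "\<not> planar G"
proof
  assume "planar G"
  then obtain p \<gamma> where d: "planar_drawing G p \<gamma>" unfolding planar_def by blast
  define C where "C k = drawn_walk \<gamma> (P k)" for k
  define D where "D k = drawn_walk \<gamma> (Q k)" for k
  have arcC: "arc_joins (C k) (p a) (p b)" if "k < 3" for k
    using arc_joins_drawn_walk[OF d walk_P[OF that]] length_P[OF that] ends_P that by (simp add: C_def)
  have arcD: "arc_joins (D k) (p c) (p (last (Q k)))" if "k < 3" for k
    using arc_joins_drawn_walk[OF d walk_Q[OF that] length_Q[OF that]] hd_Q[OF that] by (simp add: D_def)
  have walks: "walk G (P k)" "walk G (Q k)" if "k < 3" for k
    using walk_P walk_Q that by (auto simp: simple_walk_def)
  have pinC: "p v \<in> C k" if "k < 3" "v \<in> set (P k)" for k v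
    unfolding C_def by (rule drawn_walk_contains_vertices[OF d walks(1)[OF that(1)] _ that(2)])
      (use length_P[OF that(1)] in simp)
  have meetC: "C i \<inter> C j = {p a, p b}" if ij: "i < 3" "j < 3" "i \<noteq> j" for i j
  proof
    have "walk_edges (P i) \<inter> walk_edges (P j) = {}"
    proof (rule ccontr)
      assume "walk_edges (P i) \<inter> walk_edges (P j) \<noteq> {}"
      then obtain e where e: "e \<in> walk_edges (P i)" "e \<in> walk_edges (P j)" by blast
      have "e \<subseteq> {a, b}" using walk_edges_subset_set[OF e(1)] walk_edges_subset_set[OF e(2)] meet_P[OF ij] by blast
      moreover have "card e = 2" using card_walk_edge e(1) walk_P[OF ij(1)] by (auto simp: simple_walk_def)
      ultimately have "e = {a, b}"
        by (intro card_seteq) (auto simp: card_insert_if)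
      moreover have "{a, b} \<notin> walk_edges (P i)"
        using ends_not_walk_edge[of "P i"] length_P[OF ij(1)] walk_P[OF ij(1)] ends_P ij(1) by (simp add: simple_walk_def)
      ultimately show False using e by simp
    qed
    then have "C i \<inter> C j \<subseteq> p ` (set (P i) \<inter> set (P j))"
      unfolding C_def using drawn_walks_meet[OF d] walks ij by blast
    then show "C i \<inter> C j \<subseteq> {p a, p b}" using meet_P[OF ij] by auto
    show "{p a, p b} \<subseteq> C i \<inter> C j"
      using arc_joins_ends[OF arcC] ij by simp
  qed
  have meetD: "D k \<inter> C j \<subseteq> {p (last (Q k))}" if kj: "k < 3" "j < 3" for k j
  proof -
    have "walk_edges (Q k) \<inter> walk_edges (P j) = {}"
    proof (rule ccontr)
      assume "walk_edges (Q k) \<inter> walk_edges (P j) \<noteq> {}"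
      then obtain e where e: "e \<in> walk_edges (Q k)" "e \<in> walk_edges (P j)" by blast
      have "e \<subseteq> {last (Q k)}"
        using walk_edges_subset_set[OF e(1)] walk_edges_subset_set[OF e(2)] meet_Q[OF kj] by blast
      then have "card e \<le> 1" using card_mono[of "{last (Q k)}" e] by simp
      moreover have "card e = 2" using card_walk_edge e(1) walk_Q[OF kj(1)] by (auto simp: simple_walk_def)
      ultimately show False by simp
    qed
    then have "D k \<inter> C j \<subseteq> p ` (set (Q k) \<inter> set (P j))"
      unfolding C_def D_def using drawn_walks_meet[OF d] walks kj by blast
    then show ?thesis using meet_Q[OF kj] by auto
  qed
  define T where "T = (\<Union>k<3. D k - {p (last (Q k))})"
  have "Topological_Spaces.connected T"
    unfolding T_def
  proof (rule connected_Union)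
    show "Topological_Spaces.connected s" if "s \<in> (\<lambda>k. D k - {p (last (Q k))}) ` {..<3}" for s
      using arc_joins_minus_end(1)[OF arcD] that by auto
    have "p c \<in> (\<Inter>k<3. D k - {p (last (Q k))})"
      using arc_joins_minus_end(2)[OF arcD] by auto
    then show "(\<Inter>k<3. D k - {p (last (Q k))}) \<noteq> {}" by blast
  qed
  moreover have "T \<inter> (C 0 \<union> C 1 \<union> C 2) = {}"
    using meetD[of _ 0] meetD[of _ 1] meetD[of _ 2] unfolding T_def by fastforce
  moreover have "p (last (Q k)) \<in> C k - {p a, p b}" if "k < 3" for k
  proof -
    have l: "last (Q k) \<in> set (P k) - {a, b}" by (rule last_Q[OF that])
    have "inj_on p (pverts G)" using d by (simp add: planar_drawing_def)
    moreover have "last (Q k) \<in> pverts G" "a \<in> pverts G" "b \<in> pverts G"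
      using l ends_in_P[OF that] P_subset_verts[OF that] by auto
    ultimately have "p (last (Q k)) \<noteq> p a" "p (last (Q k)) \<noteq> p b"
      using l by (auto simp: inj_on_eq_iff)
    then show ?thesis using pinC[OF that] l by blast
  qed
  moreover have "p (last (Q k)) \<in> closure T" if "k < 3" for k
    using arc_joins_minus_end(3)[OF arcD[OF that]] closure_mono[of "D k - {p (last (Q k))}" T] that
    unfolding T_def by blast
  ultimately show False
    using theta_no_common_face[of "C 0" "p a" "p b" "C 1" "C 2" T "p (last (Q 0))" "p (last (Q 1))" "p (last (Q 2))"]
      arcC meetC by simp
qed

text \<open>
The two ends of the theta curve, the tripod without its feet, and the interiors of the three walks
\<open>P k\<close> are the branch sets of a \<open>K\<^sub>3\<^sub>,\<^sub>3\<close> minor; the indices \<open>3\<close>, \<open>4\<close>, \<open>5\<close> stand for the latter.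
\<close>

definition branch :: "nat \<Rightarrow> 'a set" where
  "branch x = (if x = 0 then {a} else if x = 1 then {b} else if x = 2 then \<Union>k<3. set (init_Q k)
     else set (inner_P (x - 3)))"

lemma branch_subset_verts: assumes "x < 6" shows "branch x \<subseteq> pverts G"
proof -
  have "set (init_Q k) \<subseteq> pverts G" "set (inner_P k) \<subseteq> pverts G" if "k < 3" for k
    using P_subset_verts[OF that] Q_subset_verts[OF that] set_init_Q[OF that] set_inner_P[OF that] by auto
  moreover have "a \<in> pverts G" "b \<in> pverts G"
    using P_subset_verts[of 0] ends_in_P[of 0] by auto
  moreover have "x - 3 < 3" using assms by simp
  ultimately show ?thesis unfolding branch_def by (simp add: UN_subset_iff)
qed

lemma branch_connected:
  assumes "x < 6"
  shows "Digraph_Component.connected (with_proj G \<restriction> branch x)"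
proof -
  have single: "Digraph_Component.connected (with_proj G \<restriction> {u})" for u
    by (rule connected_induced_if_rooted[of u]) (auto simp: walk_def intro!: exI[of _ "[u]"])
  have "c \<in> set (init_Q 0)" using hd_init_Q[of 0] init_Q_nonempty[of 0] hd_in_set by fastforce
  then have "c \<in> (\<Union>k<3. set (init_Q k))" by auto
  then have "Digraph_Component.connected (with_proj G \<restriction> (\<Union>k<3. set (init_Q k)))"
  proof (rule connected_induced_if_rooted)
    fix v assume "v \<in> (\<Union>k<3. set (init_Q k))"
    then obtain k where k: "k < 3" "v \<in> set (init_Q k)" by auto
    then show "\<exists>xs. walk G xs \<and> xs \<noteq> [] \<and> hd xs = c \<and> v \<in> set xs \<and> set xs \<subseteq> (\<Union>k<3. set (init_Q k))"
      using walk_init_Q(1)[OF k(1)] init_Q_nonempty[OF k(1)] hd_init_Q[OF k(1)]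
      by (intro exI[of _ "init_Q k"]) auto
  qed
  moreover have "Digraph_Component.connected (with_proj G \<restriction> set (inner_P k))" if "k < 3" for k
    by (rule connected_induced_if_rooted[of "hd (inner_P k)"])
      (use walk_inner_P(1)[OF that] inner_P_nonempty[OF that] in auto)
  ultimately show ?thesis using assms single by (simp add: branch_def)
qed

lemma branch_disjoint: assumes "x < y" "y < 6" shows "branch x \<inter> branch y = {}"
proof -
  have Q: "u \<notin> (\<Union>k<3. set (init_Q k))" if "j < 3" "u \<in> set (P j)" for u j
    using init_Q_disjoint_P[OF _ that(1)] that(2) by auto
  have P: "set (inner_P i) \<subseteq> set (P i)" "a \<notin> set (inner_P i)" "b \<notin> set (inner_P i)" if "i < 3" for i
    using set_inner_P[OF that] by auto
  consider "x = 0" | "x = 1" | "x = 2" | "x \<ge> 3" using assms by linarith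
  then show ?thesis
  proof cases
    case 1
    then show ?thesis
      using assms a_neq_b Q[of 0 a] ends_in_P[of 0] P(2)[of "y - 3"] by (simp add: branch_def)
  next
    case 2
    then show ?thesis
      using assms Q[of 0 b] ends_in_P[of 0] P(3)[of "y - 3"] by (simp add: branch_def)
  next
    case 3
    have "y - 3 < 3" using assms by simp
    then have "(\<Union>k<3. set (init_Q k)) \<inter> set (inner_P (y - 3)) = {}"
      using Q[of "y - 3"] P(1)[of "y - 3"] by blast
    then show ?thesis using 3 assms by (simp add: branch_def)
  next
    case 4
    then have "set (P (x - 3)) \<inter> set (P (y - 3)) = {a, b}" using assms by (intro meet_P) auto
    then show ?thesis
      using 4 assms set_inner_P[of "x - 3"] set_inner_P[of "y - 3"] by (auto simp: branch_def)
  qed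
qed

lemma branch_adjacent:
  assumes "x < 3" "3 \<le> y" "y < 6"
  shows "\<exists>u \<in> branch x. \<exists>v \<in> branch y. (u, v) \<in> parcs G"
proof -
  have k: "y - 3 < 3" using assms by simp
  have y: "branch y = set (inner_P (y - 3))" using assms by (simp add: branch_def)
  note ne = inner_P_nonempty[OF k] init_Q_nonempty[OF k]
  consider "x = 0" | "x = 1" | "x = 2" using assms by linarith
  then show ?thesis
  proof cases
    case 1
    then show ?thesis
      unfolding y using walk_inner_P(2)[OF k] hd_in_set[OF ne(1)] by (auto simp: branch_def)
  next
    case 2
    then show ?thesis
      unfolding y using adj_sym[OF walk_inner_P(3)[OF k]] last_in_set[OF ne(1)] by (auto simp: branch_def)
  next
    case 3
    have "last (init_Q (y - 3)) \<in> branch x"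
      using 3 k last_in_set[OF ne(2)] by (auto simp: branch_def)
    then show ?thesis
      unfolding y using walk_init_Q(2)[OF k] last_Q_inner_P[OF k] by blast
  qed
qed

theorem K33_minor:
  "\<exists>K :: nat pair_pre_digraph. K\<^bsub>3,3\<^esub> (with_proj K) \<and> minor_of K G"
proof (intro exI conjI)
  let ?K = "\<lparr>pverts = {..<3} \<union> {3..<6}, parcs = {..<3} \<times> {3..<6} \<union> {3..<6} \<times> {..<3}\<rparr> :: nat pair_pre_digraph"
  show "K\<^bsub>3,3\<^esub> (with_proj ?K)"
    unfolding complete_bipartite_digraph_pair_def
    by (intro conjI exI[of _ "{..<3}"] exI[of _ "{3..<6}"]) auto
  show "minor_of ?K G"
    unfolding minor_of_def
  proof (intro exI[of _ branch] conjI ballI allI impI)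
    show "branch x \<subseteq> pverts G" "Digraph_Component.connected (with_proj G \<restriction> branch x)"
      if "x \<in> pverts ?K" for x
      using branch_subset_verts[of x] branch_connected[of x] that by auto
    show "branch x \<inter> branch y = {}" if "x \<in> pverts ?K" "y \<in> pverts ?K" "x \<noteq> y" for x y
    proof (cases "x < y")
      case True
      then show ?thesis using branch_disjoint[of x y] that by auto
    next
      case False
      then show ?thesis using branch_disjoint[of y x] that by auto
    qed
    show "\<exists>u \<in> branch x. \<exists>v \<in> branch y. (u, v) \<in> parcs G" if "(x, y) \<in> parcs ?K" for x y
    proof (cases "x < 3")
      case True
      then show ?thesis using branch_adjacent[of x y] that by auto
    next
      case False
      then show ?thesis using branch_adjacent[of y x] that adj_sym by fastforce
    qed
  qed
qed

end

section \<open>A rotation by multiplication with two and division by three\<close>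

text \<open>
On \<open>[1, 6)\<close> this is doubling modulo multiplication by \<open>6\<close>: in the coordinate \<open>log 6 x\<close> it is the
rotation of the circle by the irrational number \<open>log 6 2\<close>. Each step is along an edge of the rational
divisor graph.
\<close>

definition step :: "rat \<Rightarrow> rat" where
  "step x = (if x < 3 then 2 * x else x / 3)"

lemma orbit_range: "1 \<le> x \<Longrightarrow> x < 6 \<Longrightarrow> 1 \<le> (step ^^ n) x \<and> (step ^^ n) x < 6"
  by (induction n) (auto simp: step_def)

lemma orbit_form: "\<exists>k. (step ^^ n) x * 6 ^ k = 2 ^ n * x"
proof (induction n)
  case 0
  show ?case by (rule exI[of _ 0]) simp
next
  case (Suc n)
  then obtain k where k: "(step ^^ n) x * 6 ^ k = 2 ^ n * x" by blast
  show ?case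
  proof (cases "(step ^^ n) x < 3")
    case True
    then show ?thesis using k by (intro exI[of _ k]) (simp add: step_def[of "(step ^^ n) x"])
  next
    case False
    then show ?thesis using k by (intro exI[of _ "Suc k"]) (simp add: step_def[of "(step ^^ n) x"])
  qed
qed

text \<open>
Two orbits rotate in step: after \<open>n\<close> steps each point has been multiplied by \<open>2 ^ n\<close> and divided by
the only power of \<open>6\<close> that brings it back to \<open>[1, 6)\<close>. If \<open>q * y\<close> is in the interval, this power is
the one that occurs in \<open>q\<close>.
\<close>

lemma orbit_scale:
  assumes x: "x > 0" and y: "1 \<le> y" "y < 6" "1 \<le> q * y" "q * y < 6" and q: "(step ^^ n) x = q * x"
  shows "(step ^^ n) y = q * y"
proof -
  obtain k where "(step ^^ n) x * 6 ^ k = 2 ^ n * x" using orbit_form by blast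
  then have k: "q * 6 ^ k = 2 ^ n" using q x by simp
  obtain l where l: "(step ^^ n) y * 6 ^ l = 2 ^ n * y" using orbit_form by blast
  define v where "v = (step ^^ n) y"
  have v: "1 \<le> v" "v < 6" using orbit_range[OF y(1,2)] by (auto simp: v_def)
  have eq: "v * 6 ^ l = q * y * 6 ^ k" using l k by (simp add: v_def mult_ac)
  have large: "6 \<le> t * 6 ^ Suc d" if "1 \<le> t" for t :: rat and d
    using mult_mono[of 1 t 6 "6 ^ Suc d"] that by simp
  consider "k = l" | d where "k = l + Suc d" | d where "l = k + Suc d"
    by (metis add_Suc_right less_iff_Suc_add linorder_neqE_nat)
  then show ?thesis
  proof cases
    case 1
    then show ?thesis using eq by (simp add: v_def)
  next
    case 2
    then have "v = q * y * 6 ^ Suc d" using eq by (simp add: power_add)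
    then show ?thesis using large[OF y(3), of d] v by simp
  next
    case 3
    then have "v * 6 ^ Suc d = q * y" using eq by (simp add: power_add)
    then show ?thesis using large[OF v(1), of d] y by simp
  qed
qed

lemma not_dvd_2_6:
  fixes p :: nat
  assumes "prime p" "p \<noteq> 2" "p \<noteq> 3"
  shows "\<not> p dvd 2 ^ i * 6 ^ k"
proof
  assume "p dvd 2 ^ i * 6 ^ k"
  also have "(2::nat) ^ i * 6 ^ k = 2 ^ (i + k) * 3 ^ k"
    by (simp add: power_add flip: power_mult_distrib)
  finally show False
    using assms prime_dvd_power[of p 2 "i + k"] prime_dvd_power[of p 3 k]
    by (auto simp: prime_dvd_mult_iff primes_dvd_imp_eq)
qed

text \<open>
A repeated point would give a relation \<open>6 ^ k * 2 ^ j = 6 ^ l * 2 ^ i\<close>, and the prime \<open>3\<close> forces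
\<open>k = l\<close>.
\<close>

lemma orbit_inj:
  assumes "1 \<le> x" "x < 6" "(step ^^ i) x = (step ^^ j) x"
  shows "i = j"
proof -
  have nat_eq: "i = j" if eq: "(6::nat) ^ k * 2 ^ j = 6 ^ l * 2 ^ i" for i j k l :: nat
  proof -
    have le: "i = j" if "k \<le> l" "(6::nat) ^ k * 2 ^ j = 6 ^ l * 2 ^ i" for i j k l :: nat
    proof -
      obtain d where d: "l = k + d" using \<open>k \<le> l\<close> le_Suc_ex by blast
      then have e: "2 ^ j = (6::nat) ^ d * 2 ^ i" using that(2) by (simp add: power_add)
      have "d = 0"
      proof (rule ccontr)
        assume "d \<noteq> 0"
        then have "(3::nat) dvd 6 ^ d" by (intro dvd_power_le[of 3 6 1 d, simplified]) auto
        then have "(3::nat) dvd 2 ^ j" using e by simp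
        then show False using prime_dvd_power[of "3::nat" 2 j] by simp
      qed
      then show ?thesis using e by simp
    qed
    show ?thesis using le[of k l j i] le[of l k i j] eq by (metis linorder_linear)
  qed
  obtain k where k: "(step ^^ i) x * 6 ^ k = 2 ^ i * x" using orbit_form by blast
  obtain l where l: "(step ^^ j) x * 6 ^ l = 2 ^ j * x" using orbit_form by blast
  define v where "v = (step ^^ i) x"
  have v: "v \<ge> 1" using orbit_range assms v_def by simp
  have "v * 6 ^ k * (2 ^ j * x) = v * 6 ^ l * (2 ^ i * x)"
    using k l assms(3) by (simp add: v_def)
  then have "(6::rat) ^ k * 2 ^ j = 6 ^ l * 2 ^ i" using v assms(1) by simp
  then have "of_nat (6 ^ k * 2 ^ j) = (of_nat (6 ^ l * 2 ^ i) :: rat)" by simp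
  then show ?thesis using nat_eq[of k j l i] by (simp only: of_nat_eq_iff)
qed

text \<open>
For positive \<open>x\<close> and \<open>y\<close> this says that \<open>x / y\<close> lies in the group generated by \<open>2\<close> and \<open>3\<close>. The powers
of \<open>6\<close> match those that occur along an orbit.
\<close>

definition same_coset :: "rat \<Rightarrow> rat \<Rightarrow> bool" where
  "same_coset x y \<longleftrightarrow> (\<exists>i k j l. 2 ^ i * 6 ^ k * x = 2 ^ j * 6 ^ l * y)"

lemma same_cosetI: "2 ^ i * 6 ^ k * x = 2 ^ j * 6 ^ l * y \<Longrightarrow> same_coset x y"
  unfolding same_coset_def by blast

lemma same_coset_sym: "same_coset x y \<Longrightarrow> same_coset y x"
  unfolding same_coset_def by metis

lemma same_coset_trans:
  assumes "same_coset x y" "same_coset y z" shows "same_coset x z"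
proof -
  obtain i k j l where 1: "2 ^ i * 6 ^ k * x = 2 ^ j * 6 ^ l * y" using assms(1) same_coset_def by auto
  obtain i' k' j' l' where 2: "2 ^ i' * 6 ^ k' * y = 2 ^ j' * 6 ^ l' * z" using assms(2) same_coset_def by auto
  have "2 ^ (i + i') * 6 ^ (k + k') * x = 2 ^ i' * 6 ^ k' * (2 ^ i * 6 ^ k * x)"
    by (simp add: power_add mult_ac)
  also have "\<dots> = 2 ^ j * 6 ^ l * (2 ^ i' * 6 ^ k' * y)" unfolding 1 by (simp add: mult_ac)
  also have "\<dots> = 2 ^ (j + j') * 6 ^ (l + l') * z" unfolding 2 by (simp add: power_add mult_ac)
  finally show ?thesis by (rule same_cosetI)
qed

lemma same_coset_mult: "same_coset x y \<Longrightarrow> same_coset (t * x) (t * y)"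
proof -
  assume "same_coset x y"
  then obtain i k j l where 1: "2 ^ i * 6 ^ k * x = 2 ^ j * 6 ^ l * y" using same_coset_def by auto
  have "2 ^ i * 6 ^ k * (t * x) = t * (2 ^ i * 6 ^ k * x)" by (simp add: mult_ac)
  also have "\<dots> = 2 ^ j * 6 ^ l * (t * y)" unfolding 1 by (simp add: mult_ac)
  finally show ?thesis by (rule same_cosetI)
qed

lemma same_coset_orbit: "same_coset x ((step ^^ n) x)"
proof -
  obtain k where "(step ^^ n) x * 6 ^ k = 2 ^ n * x" using orbit_form by blast
  then have "2 ^ n * 6 ^ 0 * x = 2 ^ 0 * 6 ^ k * (step ^^ n) x" by (simp add: mult_ac)
  then show ?thesis by (rule same_cosetI)
qed

lemma not_same_coset:
  fixes s t :: nat
  assumes p: "prime p" "p \<noteq> 2" "p \<noteq> 3" and "p dvd s" "\<not> p dvd t"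
  shows "\<not> same_coset (of_nat s) (of_nat t)"
proof
  assume "same_coset (of_nat s) (of_nat t)"
  then obtain i k j l where "(2::rat) ^ i * 6 ^ k * of_nat s = 2 ^ j * 6 ^ l * of_nat t"
    using same_coset_def by auto
  then have "of_nat (2 ^ i * 6 ^ k * s) = (of_nat (2 ^ j * 6 ^ l * t) :: rat)" by simp
  then have "2 ^ i * 6 ^ k * s = 2 ^ j * 6 ^ l * t" by (simp only: of_nat_eq_iff)
  then have "p dvd 2 ^ j * 6 ^ l * t" using assms(4) by (metis dvd_mult)
  then show False using not_dvd_2_6[OF p] assms(5) p(1) by (simp add: prime_dvd_mult_iff)
qed

text \<open>
Infinitely many orbit points fit into the bounded interval \<open>[1, 6)\<close>, so two of them lie in the same
cell of length \<open>\<delta>\<close>.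
\<close>

lemma near_return:
  assumes "\<delta> > (0::rat)"
  obtains n x q where "x > 0" "(step ^^ n) x = q * x" "q \<noteq> 1" "\<bar>q - 1\<bar> < \<delta>"
proof -
  define h where "h i = (step ^^ i) 1" for i :: nat
  have h: "1 \<le> h i" "h i < 6" for i using orbit_range[of 1 i] by (auto simp: h_def)
  have "range (\<lambda>i. \<lfloor>h i / \<delta>\<rfloor>) \<subseteq> {0..\<lfloor>6 / \<delta>\<rfloor>}"
    using h assms by (auto intro!: floor_mono divide_right_mono simp: less_imp_le) (meson divide_nonneg_pos order_trans zero_le_one)
  then have "\<not> inj (\<lambda>i. \<lfloor>h i / \<delta>\<rfloor>)"
    using finite_subset finite_imageD by blast
  then obtain i j where ij: "i < j" "\<lfloor>h i / \<delta>\<rfloor> = \<lfloor>h j / \<delta>\<rfloor>"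
    unfolding inj_def by (metis linorder_neqE_nat)
  have "\<bar>h j / \<delta> - h i / \<delta>\<bar> < 1" using ij(2) by linarith
  moreover have "h j / \<delta> - h i / \<delta> = (h j - h i) / \<delta>" by (simp add: diff_divide_distrib)
  ultimately have "\<bar>h j - h i\<bar> < \<delta>" using assms by (simp add: abs_divide)
  show thesis
  proof (rule that[of "h i" "j - i" "h j / h i"])
    show "(step ^^ (j - i)) (h i) = h j / h i * h i"
      using ij(1) h(1)[of i] by (simp add: h_def flip: funpow_add[THEN fun_cong, unfolded comp_apply])
    have "h j \<noteq> h i" using orbit_inj[of 1 i j] ij(1) unfolding h_def by force
    then show "h j / h i \<noteq> 1" using h(1)[of i] by simp
    have "\<bar>h j / h i - 1\<bar> = \<bar>h j - h i\<bar> / h i" using h(1)[of i] by (simp add: field_simps)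
    also have "\<dots> \<le> \<bar>h j - h i\<bar> / 1" using h(1)[of i] by (intro divide_left_mono) auto
    finally show "\<bar>h j / h i - 1\<bar> < \<delta>" using \<open>\<bar>h j - h i\<bar> < \<delta>\<close> by simp
  qed (use ij h(1)[of i] in auto)
qed

text \<open>
The return factor \<open>q\<close> may be above or below \<open>1\<close>. Accordingly the progression \<open>z\<close>, \<open>q * z\<close>,
\<open>q * (q * z)\<close> is started at \<open>1\<close> or made to end there.
\<close>

lemma ex_near_one_progression:
  assumes "0 < r" "r \<le> (1/6 :: rat)"
  obtains n x q z where "x > 0" "(step ^^ n) x = q * x" "q > 0" "q \<noteq> 1" "same_coset 1 z" "same_coset 1 q"
    "1 \<le> z" "z < 1 + r" "1 \<le> q * z" "q * z < 1 + r" "1 \<le> q * (q * z)" "q * (q * z) < 1 + r"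
proof -
  \<comment> \<open>The progression spans the factor \<open>q * q\<close> or its inverse, which is about \<open>1 + 2 * \<bar>q - 1\<bar>\<close>.\<close>
  have "0 < r / 3" using assms(1) by simp
  then obtain n x q where n: "x > 0" "(step ^^ n) x = q * x" "q \<noteq> 1" and q: "\<bar>q - 1\<bar> < r / 3"
    by (rule near_return)
  have q0: "q > 0" using q assms by (simp add: abs_if split: if_splits)
  have sc: "same_coset 1 q"
  proof -
    have "same_coset (1 / x * x) (1 / x * (q * x))"
      using same_coset_mult[OF same_coset_orbit[of x n]] n(2) by metis
    then show ?thesis using n(1) by simp
  qed
  show thesis
  proof (cases "q > 1")
    case True
    define e where "e = q - 1"
    have e: "0 < e" "e < r / 3" "e < 1" using q True assms by (auto simp: e_def)
    have "q * q = 1 + 2 * e + e * e" by (simp add: e_def algebra_simps)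
    moreover have "e * e < e" using mult_strict_right_mono[OF e(3,1)] by simp
    ultimately have qq: "q * q < 1 + r" using e by linarith
    have "1 \<le> q * q" using True mult_mono[of 1 q 1 q] by simp
    moreover have "same_coset 1 1" by (rule same_cosetI[of 0 0 _ 0 0]) simp
    moreover have "q < 1 + r" using e assms by (simp add: e_def)
    ultimately show thesis
      using True qq assms by (intro that[OF n(1,2) q0 n(3) _ sc, of 1]) simp_all
  next
    case False
    then have q1: "q < 1" using n(3) by simp
    define e where "e = 1 - q"
    have e: "0 < e" "e < r / 3" "e < 1" using q q1 assms by (auto simp: e_def)
    have "q * q * (1 + r) > 1"
    proof -
      have "q * q = (1 - 2 * e) + e * e" by (simp add: e_def algebra_simps)
      then have "q * q * (1 + r) > (1 - 2 * e) * (1 + r)" using e assms by simp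
      moreover have "(1 - 2 * e) * (1 + r) > (1 - 2 * (r / 3)) * (1 + r)"
        using e assms by (intro mult_strict_right_mono) auto
      moreover have "(1 - 2 * (r / 3)) * (1 + r) = 1 + r / 3 - 2 / 3 * (r * r)" by (simp add: field_simps)
      moreover have "r * r \<le> r * (1 / 6)" using assms by (intro mult_left_mono) auto
      ultimately show ?thesis using assms(1) by linarith
    qed
    then have qq: "1 / (q * q) < 1 + r" using q0 by (simp add: field_simps)
    have le: "1 \<le> 1 / q" using q0 q1 by simp
    moreover have "1 / q \<le> 1 / (q * q)" using q0 q1 by (simp add: field_simps)
    ultimately have "1 \<le> 1 / (q * q)" by simp
    moreover have "q * (1 / (q * q)) = 1 / q" "q * (1 / q) = 1" using q0 by simp_all
    moreover have "same_coset 1 (1 / (q * q))"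
    proof -
      have "same_coset (1 / (q * q) * 1) (1 / (q * q) * q)" "same_coset (1 / q * 1) (1 / q * q)"
        using sc same_coset_mult by blast+
      then have "same_coset (1 / (q * q)) (1 / q)" "same_coset (1 / q) 1" using q0 by simp_all
      then show ?thesis using same_coset_trans same_coset_sym by blast
    qed
    moreover have "1 / q < 1 + r" using qq \<open>1 / q \<le> 1 / (q * q)\<close> by simp
    ultimately show thesis
      using le qq assms by (intro that[OF n(1,2) q0 n(3) _ sc, of "1 / (q * q)"]) simp_all
  qed
qed

section \<open>Three orbits attached to three vertices above one\<close>

lemma walk_map_upt:
  assumes "\<And>i. (g i, g (Suc i)) \<in> parcs G"
  shows "walk G (map g [0..<m])"
proof (induction m)
  case (Suc m)
  then show ?case
    using assms[of "m - 1"] by (cases m) (auto simp: walk_def successively_append_iff)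
qed (simp add: walk_def)

text \<open>
From a vertex \<open>x\<close> slightly above \<open>1\<close> one reaches \<open>ratio k * x\<close> in \<open>[1, 6)\<close> through the vertices
\<open>link k x\<close>: directly for \<open>5 * x\<close>, through \<open>6 * x\<close> for \<open>6 / 5 * x\<close>, and through \<open>7 * x\<close> for \<open>7 / 3 * x\<close>.
The last one is where vertices above \<open>7\<close> are used.
\<close>

definition ratio :: "nat \<Rightarrow> rat" where
  "ratio k = (if k = 0 then 5 else if k = 1 then 6 / 5 else 7 / 3)"

definition link :: "nat \<Rightarrow> rat \<Rightarrow> rat list" where
  "link k x = (if k = 0 then [x] else if k = 1 then [x, 6 * x] else [x, 7 * x])"

lemma not_same_coset_scaled:
  assumes "prime p" "p \<noteq> 2" "p \<noteq> 3" "p dvd s" "\<not> p dvd t" "d * x = of_nat s" "d * y = of_nat t"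
  shows "\<not> same_coset x y" "\<not> same_coset y x"
  using not_same_coset[OF assms(1-5)] same_coset_mult[of x y d] same_coset_sym assms(6,7) by auto

text \<open>
After clearing denominators, one of the primes \<open>5\<close> and \<open>7\<close> divides exactly one of the two ratios.
\<close>

lemma not_same_coset_ratio:
  assumes "i < 3" "j < 3" "i \<noteq> j"
  shows "\<not> same_coset (ratio i) (ratio j)"
proof -
  have p: "prime (5::nat)" "prime (7::nat)" by simp_all
  have "\<not> same_coset 5 (6 / 5)" "\<not> same_coset (6 / 5) 5"
    using not_same_coset_scaled[OF p(1), of 25 6 5 5 "6 / 5"] by auto
  moreover have "\<not> same_coset (7 / 3) 5" "\<not> same_coset 5 (7 / 3)"
    using not_same_coset_scaled[OF p(2), of 7 15 3 "7 / 3" 5] by auto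
  moreover have "\<not> same_coset (7 / 3) (6 / 5)" "\<not> same_coset (6 / 5) (7 / 3)"
    using not_same_coset_scaled[OF p(2), of 35 18 15 "7 / 3" "6 / 5"] by auto
  moreover have "i = 0 \<or> i = 1 \<or> i = 2" "j = 0 \<or> j = 1 \<or> j = 2" using assms by auto
  ultimately show ?thesis using assms(3) by (auto simp: ratio_def)
qed

lemma not_same_coset_1_ratio: "\<not> same_coset 1 (ratio k)"
proof -
  have p: "prime (5::nat)" "prime (7::nat)" by simp_all
  have "\<not> same_coset 1 5" using not_same_coset_scaled(2)[OF p(1), of 5 1 1 5 1] by simp
  moreover have "\<not> same_coset 1 (6 / 5)" using not_same_coset_scaled(1)[OF p(1), of 5 6 5 1 "6 / 5"] by simp
  moreover have "\<not> same_coset 1 (7 / 3)" using not_same_coset_scaled(2)[OF p(2), of 7 3 3 "7 / 3" 1] by simp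
  ultimately show ?thesis by (simp add: ratio_def)
qed

lemma divisor_graph_adj:
  assumes "u \<in> S" "v \<in> S" "u > 0" "v = of_nat n * u" "n \<ge> 2"
  shows "(u, v) \<in> parcs (rational_divisor_graph S)"
proof -
  have "of_nat n \<noteq> (1::rat)" using assms(5) by simp
  then have "u \<noteq> v" using assms(3,4) by simp
  moreover have "n \<ge> 1" using assms(5) by simp
  then have "\<exists>m::nat. m \<ge> 1 \<and> (u = of_nat m * v \<or> v = of_nat m * u)" using assms(4) by blast
  ultimately show ?thesis using assms(1,2) unfolding rational_divisor_graph_def by simp
qed

lemma link_subset: "set (link k y) \<subseteq> {y, 6 * y, 7 * y}"
  by (auto simp: link_def)

lemma hd_link: "link k y \<noteq> []" "hd (link k y) = y" "y \<in> set (link k y)"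
  by (auto simp: link_def)

text \<open>
The window \<open>[1, 7 + 7 * r)\<close> contains \<open>7 * y\<close> for each term \<open>y\<close> of the progression. The bound \<open>1 / 6\<close>
keeps \<open>5 * y\<close> below \<open>6\<close> and \<open>6 * y\<close> below \<open>7\<close>.
\<close>

locale near_one_progression =
  fixes r :: rat and S :: "rat set" and z q :: rat and n :: nat
  assumes r: "0 < r" "r \<le> 1 / 6"
    and interval: "1 \<le> x \<Longrightarrow> x < 7 + 7 * r \<Longrightarrow> x \<in> S"
    and q: "0 < q" "q \<noteq> 1"
    and cosets: "same_coset 1 z" "same_coset 1 q"
    and near_one: "1 \<le> z" "z < 1 + r" "1 \<le> q * z" "q * z < 1 + r" "1 \<le> q * (q * z)" "q * (q * z) < 1 + r"
    and return: "\<exists>x>0. (step ^^ n) x = q * x"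
begin

abbreviation "G \<equiv> rational_divisor_graph S"

sublocale pair_bidirected_digraph G
  by (rule pair_bidirected_digraph_rational_divisor_graph)

lemma adj:
  assumes "1 \<le> u" "v < 7 + 7 * r" "v = of_nat m * u" "m \<ge> 2"
  shows "(u, v) \<in> parcs G" "(v, u) \<in> parcs G"
proof -
  have "1 * u \<le> of_nat m * u" using assms by (intro mult_right_mono) auto
  then have "u \<le> v" using assms(3) by simp
  then show "(u, v) \<in> parcs G"
    by (intro divisor_graph_adj[of u S v m] interval) (use assms in linarith)+
  then show "(v, u) \<in> parcs G" by (rule adj_sym)
qed

definition "z1 = q * z"
definition "z2 = q * z1"
definition "Z = {z, z1, z2}"

lemma Z_members: "z \<in> Z" "z1 \<in> Z" "z2 \<in> Z"
  by (auto simp: Z_def)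

lemma Z_distinct: "z \<noteq> z1" "z1 \<noteq> z2" "z \<noteq> z2"
proof -
  show "z \<noteq> z1" "z1 \<noteq> z2" using q near_one by (auto simp: z1_def z2_def)
  have "q * q \<noteq> 1" using q by (auto simp: square_eq_1_iff)
  then show "z \<noteq> z2" using near_one by (simp add: z1_def z2_def)
qed

lemma Z_bounds: "y \<in> Z \<Longrightarrow> 1 \<le> y" "y \<in> Z \<Longrightarrow> y < 1 + r" "y \<in> Z \<Longrightarrow> y < 7 / 6"
  using near_one r by (auto simp: Z_def z1_def z2_def)

lemma Z_coset: assumes "y \<in> Z" shows "same_coset 1 y"
proof -
  have "same_coset y (q * y)" for y
    using same_coset_mult[OF cosets(2), of y] by (simp add: mult.commute)
  then have "same_coset 1 z1" "same_coset 1 z2"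
    using cosets(1) same_coset_trans unfolding z1_def z2_def by blast+
  then show ?thesis using assms cosets(1) by (auto simp: Z_def)
qed

lemma ratio_range: "y \<in> Z \<Longrightarrow> 1 \<le> ratio k * y" "y \<in> Z \<Longrightarrow> ratio k * y < 6"
  using Z_bounds[of y] by (auto simp: ratio_def)

definition spine :: "nat \<Rightarrow> nat \<Rightarrow> rat" where "spine k i = (step ^^ i) (ratio k * z)"

lemma spine_range: "1 \<le> spine k i" "spine k i < 6"
  using orbit_range ratio_range[OF Z_members(1)] by (auto simp: spine_def)

lemma orbit_ratio:
  assumes "y \<in> Z" "q * y \<in> Z"
  shows "(step ^^ n) (ratio k * y) = ratio k * (q * y)"
proof -
  obtain x where "x > 0" "(step ^^ n) x = q * x" using return by blast
  then show ?thesis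
    using orbit_scale[of x "ratio k * y" q n] ratio_range[OF assms(1), of k]
      ratio_range[OF assms(2), of k] by (simp add: mult.left_commute)
qed

text \<open>
Each of the three orbits passes the points attached to \<open>z\<close>, \<open>z1\<close> and \<open>z2\<close> in this order, because
multiplication by \<open>q\<close> takes \<open>n\<close> steps on all of them.
\<close>

lemma spine_at_Z: "spine k 0 = ratio k * z" "spine k n = ratio k * z1" "spine k (n + n) = ratio k * z2"
proof -
  show "spine k 0 = ratio k * z" by (simp add: spine_def)
  show spine_n: "spine k n = ratio k * z1"
    using orbit_ratio[of z k] Z_members unfolding spine_def z1_def by blast
  show "spine k (n + n) = ratio k * z2"
    using orbit_ratio[of z1 k] Z_members spine_n unfolding spine_def z2_def by (simp add: funpow_add)
qed

lemma spine_coset: "same_coset (ratio k) (spine k i)"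
  using same_coset_trans[OF same_coset_mult[OF Z_coset[OF Z_members(1)], of "ratio k"] same_coset_orbit]
  unfolding spine_def by simp

lemma spine_inj: "inj (spine k)"
proof (rule injI)
  fix i j assume "spine k i = spine k j"
  then show "i = j"
    using orbit_inj[of "ratio k * z" i j] ratio_range[OF Z_members(1), of k] by (simp add: spine_def)
qed

lemma spine_adj: "(spine k i, spine k (Suc i)) \<in> parcs G"
proof (cases "spine k i < 3")
  case True
  then have "spine k (Suc i) = of_nat 2 * spine k i"
    by (simp add: spine_def step_def[of "(step ^^ i) (ratio k * z)"])
  then show ?thesis using spine_range[of k i] spine_range[of k "Suc i"] r by (intro adj(1)) auto
next
  case False
  then have "spine k i = of_nat 3 * spine k (Suc i)"
    by (simp add: spine_def step_def[of "(step ^^ i) (ratio k * z)"])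
  then show ?thesis using spine_range[of k i] spine_range[of k "Suc i"] r by (intro adj(2)) auto
qed

lemma range_spine_disjoint: assumes "i < 3" "j < 3" "i \<noteq> j" shows "range (spine i) \<inter> range (spine j) = {}"
proof -
  have "spine i s \<noteq> spine j t" for s t
    using not_same_coset_ratio[OF assms] spine_coset same_coset_trans same_coset_sym by metis
  then show ?thesis by auto
qed

lemma spine_notin_Z: "spine k i \<notin> Z"
  using not_same_coset_1_ratio spine_coset Z_coset same_coset_trans same_coset_sym by metis

text \<open>
The orbits stay below \<open>6\<close>, hence away from \<open>6 * y\<close> and \<open>7 * y\<close>; from \<open>y\<close> itself they are separated by
their coset.
\<close>

lemma range_spine_disjoint_link: assumes "y \<in> Z" shows "range (spine k) \<inter> set (link j y) = {}"
proof -
  have "spine k i \<notin> {y, 6 * y, 7 * y}" for i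
    using spine_notin_Z[of k i] spine_range[of k i] Z_bounds[OF assms] assms by auto
  then show ?thesis using link_subset[of j y] by blast
qed

lemma link_disjoint:
  assumes "y \<in> Z" "w \<in> Z" "y \<noteq> w"
  shows "set (link i y) \<inter> set (link j w) = {}"
proof -
  have "{y, 6 * y, 7 * y} \<inter> {w, 6 * w, 7 * w} = {}"
    using Z_bounds[OF assms(1)] Z_bounds[OF assms(2)] assms(3) by auto
  then show ?thesis using link_subset by blast
qed

lemma link_meet: "y \<in> Z \<Longrightarrow> i < 3 \<Longrightarrow> j < 3 \<Longrightarrow> i \<noteq> j \<Longrightarrow> set (link i y) \<inter> set (link j y) = {y}"
  using Z_bounds[of y] by (auto simp: link_def)

lemma link_walk:
  assumes "y \<in> Z"
  shows "simple_walk G (link k y)" "(last (link k y), ratio k * y) \<in> parcs G"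
proof -
  have y: "1 \<le> y" "y < 1 + r" "y < 7 / 6" using Z_bounds[OF assms] by auto
  have "(y, 6 * y) \<in> parcs G" by (rule adj(1)[of _ _ 6]) (use y r in simp_all)
  moreover have "(y, 7 * y) \<in> parcs G" by (rule adj(1)[of _ _ 7]) (use y r in simp_all)
  moreover have "(y, 5 * y) \<in> parcs G" by (rule adj(1)[of _ _ 5]) (use y r in simp_all)
  moreover have "(6 * y, 6 / 5 * y) \<in> parcs G" by (rule adj(2)[of _ _ 5]) (use y r in simp_all)
  moreover have "(7 * y, 7 / 3 * y) \<in> parcs G" by (rule adj(2)[of _ _ 3]) (use y r in simp_all)
  ultimately show "simple_walk G (link k y)" "(last (link k y), ratio k * y) \<in> parcs G"
    using y(1) by (simp_all add: link_def ratio_def simple_walk_def walk_def)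
qed

text \<open>
The branch vertices \<open>z\<close> and \<open>z2\<close> are joined along the three orbits, and \<open>z1\<close> is attached to each
orbit at its middle point.
\<close>

definition P :: "nat \<Rightarrow> rat list" where
  "P k = link k z @ map (spine k) [0..<Suc (n + n)] @ rev (link k z2)"

definition Q :: "nat \<Rightarrow> rat list" where
  "Q k = link k z1 @ [ratio k * z1]"

lemma set_P: "set (P k) = set (link k z) \<union> spine k ` {0..<Suc (n + n)} \<union> set (link k z2)"
  by (simp only: P_def set_append set_map set_upt set_rev Un_assoc)

lemma set_P_subset: "set (P k) \<subseteq> set (link k z) \<union> range (spine k) \<union> set (link k z2)"
  unfolding set_P by blast

lemma set_Q: "set (Q k) = insert (ratio k * z1) (set (link k z1))"
  by (simp add: Q_def)

lemma walk_P: "walk G (P k)"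
proof -
  have "walk G (rev (link k z2))"
    using link_walk(1)[OF Z_members(3), of k] adj_sym
    unfolding simple_walk_def walk_def by (auto elim: successively_mono)
  moreover have "(spine k (n + n), last (link k z2)) \<in> parcs G"
    using adj_sym[OF link_walk(2)[OF Z_members(3), of k]] spine_at_Z(3)[of k] by simp
  moreover have "last (map (spine k) [0..<Suc (n + n)]) = spine k (n + n)" by simp
  ultimately have "walk G (map (spine k) [0..<Suc (n + n)] @ rev (link k z2))"
    using walk_map_upt[of "spine k" G "Suc (n + n)", OF spine_adj] hd_link(1)[of k z2]
    by (simp add: walk_def successively_append_iff hd_rev del: upt_Suc)
  moreover have "hd (map (spine k) [0..<Suc (n + n)] @ rev (link k z2)) = ratio k * z"
    using spine_at_Z(1)[of k] by (simp add: upt_conv_Cons del: upt_Suc)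
  ultimately show ?thesis
    using link_walk[OF Z_members(1), of k]
    by (simp add: P_def walk_def simple_walk_def successively_append_iff del: upt_Suc)
qed

lemma distinct_P: "distinct (P k)"
proof -
  have "distinct (map (spine k) [0..<Suc (n + n)])"
    using inj_on_subset[OF spine_inj[of k]] by (simp only: distinct_map distinct_upt simp_thms subset_UNIV)
  moreover have "set (map (spine k) [0..<Suc (n + n)]) \<subseteq> range (spine k)" by (simp only: set_map) blast
  moreover have "distinct (link k z)" "distinct (link k z2)"
    using link_walk Z_members by (auto simp: simple_walk_def)
  ultimately show ?thesis
    unfolding P_def distinct_append distinct_rev set_append set_rev
    using range_spine_disjoint_link[OF Z_members(1), of k k] range_spine_disjoint_link[OF Z_members(3), of k k]
      link_disjoint[OF Z_members(1,3) Z_distinct(3), of k k] by blast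
qed

lemma last_Q: "last (Q k) = spine k n"
  by (simp add: Q_def spine_at_Z)

lemma link_z1_disjoint_P: "set (link k z1) \<inter> set (P j) = {}"
  using link_disjoint[OF Z_members(2,1) Z_distinct(1)[symmetric], of k j] set_P_subset[of j]
    link_disjoint[OF Z_members(2,3) Z_distinct(2), of k j] range_spine_disjoint_link[OF Z_members(2), of j k]
  by blast

sublocale K33: K33_subdivision G z z2 z1 P Q
proof
  fix k :: nat assume k: "k < 3"
  show "simple_walk G (P k)" using walk_P distinct_P by (simp add: simple_walk_def)
  show "hd (P k) = z" "last (P k) = z2" using hd_link by (simp_all add: P_def last_rev)
  have "ratio k * z1 \<notin> set (link k z1)"
    using range_spine_disjoint_link[OF Z_members(2), of k k] spine_at_Z(2)[of k] by (metis disjoint_iff rangeI)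
  then show "simple_walk G (Q k)"
    using link_walk[OF Z_members(2), of k]
    by (simp add: Q_def simple_walk_def walk_def successively_append_iff)
  show "hd (Q k) = z1" "Q k \<noteq> []" using hd_link by (simp_all add: Q_def)
  have "spine k n \<in> set (P k)" unfolding set_P by auto
  then show "last (Q k) \<in> set (P k) - {z, z2}"
    using spine_notin_Z[of k n] Z_members unfolding last_Q by auto
  show "z1 \<notin> set (P k)"
    using link_z1_disjoint_P[of k k] hd_link(3)[of z1 k] by blast
  fix j :: nat assume j: "j < 3"
  show "set (Q k) \<inter> set (P j) \<subseteq> {last (Q k)}"
    using link_z1_disjoint_P[of k j] spine_at_Z(2)[of k] unfolding set_Q last_Q by auto
next
  fix i j :: nat assume ij: "i < 3" "j < 3" "i \<noteq> j"
  have comm: "set (link k y) \<inter> range (spine m) = {}" if "y \<in> Z" for k m y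
    using range_spine_disjoint_link[OF that] by (simp add: Int_commute)
  show "set (P i) \<inter> set (P j) = {z, z2}"
  proof
    have "set (P i) \<inter> set (P j) \<subseteq> (set (link i z) \<union> range (spine i) \<union> set (link i z2)) \<inter>
        (set (link j z) \<union> range (spine j) \<union> set (link j z2))"
      by (intro Int_mono set_P_subset)
    also have "\<dots> = {z, z2}"
      unfolding Int_Un_distrib Int_Un_distrib2 range_spine_disjoint[OF ij]
        range_spine_disjoint_link[OF Z_members(1)] range_spine_disjoint_link[OF Z_members(3)]
        comm[OF Z_members(1)] comm[OF Z_members(3)]
        link_meet[OF Z_members(1) ij] link_meet[OF Z_members(3) ij]
        link_disjoint[OF Z_members(1,3) Z_distinct(3)]
        link_disjoint[OF Z_members(3,1) Z_distinct(3)[symmetric]] by auto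
    finally show "set (P i) \<inter> set (P j) \<subseteq> {z, z2}" .
    show "{z, z2} \<subseteq> set (P i) \<inter> set (P j)" unfolding set_P using hd_link(3) by auto
  qed
qed

end

theorem theorem2p5:
  fixes \<epsilon> :: real
  assumes "\<epsilon> > 0"
  defines "G \<equiv> rational_divisor_graph {q. real_of_rat q \<in> {1..<7 + \<epsilon>}}"
  shows "(\<exists>K :: nat pair_pre_digraph. K\<^bsub>3,3\<^esub> (with_proj K) \<and> minor_of K G) \<and> \<not> planar G"
proof -
  obtain r where r: "0 < real_of_rat r" "real_of_rat r < min (\<epsilon> / 7) (1 / 6)"
    using of_rat_dense[of 0 "min (\<epsilon> / 7) (1 / 6)"] assms(1) by auto
  have "real_of_rat r < real_of_rat (1 / 6)" using r(2) by (simp add: of_rat_divide)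
  then have r': "0 < r" "r \<le> 1 / 6" using r(1) by (simp_all add: of_rat_less)
  obtain n x q z where n: "x > 0" "(step ^^ n) x = q * x" "q > 0" "q \<noteq> 1" "same_coset 1 z"
    "same_coset 1 q" "1 \<le> z" "z < 1 + r" "1 \<le> q * z" "q * z < 1 + r" "1 \<le> q * (q * z)" "q * (q * z) < 1 + r"
    by (rule ex_near_one_progression[OF r'])
  have "\<exists>x>0. (step ^^ n) x = q * x" using n(1,2) by blast
  moreover have "x \<in> {q. real_of_rat q \<in> {1..<7 + \<epsilon>}}" if "1 \<le> x" "x < 7 + 7 * r" for x
  proof -
    have "real_of_rat x < real_of_rat (7 + 7 * r)" using that(2) by (simp only: of_rat_less)
    also have "\<dots> = 7 + 7 * real_of_rat r" by (simp add: of_rat_add of_rat_mult)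
    also have "\<dots> < 7 + \<epsilon>" using r(2) by simp
    finally show ?thesis using that(1) by simp
  qed
  ultimately interpret near_one_progression r "{q. real_of_rat q \<in> {1..<7 + \<epsilon>}}" z q n
    using r' n(3-) by (intro near_one_progression.intro)
  show ?thesis using K33.K33_minor K33.not_planar unfolding G_def by (rule conjI)
qed

end
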